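(* Suppose a sequence $X$ of Read operations takes time $T(M,B)$ to execute ephemerally in the cache-oblivious model on a machine with memory $M$ and block size $B$ and an initially empty memory. Then in the persistent data structure described in the context, the runtime of $X$ is $O(T(M/3,B))$.
   Context: Cache-oblivious model: a machine has internal memory of $M$ cells and external memory partitioned into blocks of $B$ consecutive cells; cost is the number of block transfers, with optimal block replacement; the algorithm does not know $M,B$. An ephemeral structure manipulates a memory array $A$ with primitives Read$(i)$ (return $A[i]$) and Write$(i,x)$ (set $A[i]=x$). The ephemeral cost $T(M,B)$ of a sequence of primitives starting with empty internal memory is computed by partitioning $A$ into blocks of size $B$: a primitive costs $0$ if its cell lies in one of the $M/B$ blocks most recently touched by earlier primitives and $1$ otherwise. Persistent structure: Writes are numbered; $V$ is the number of Writes so far. It keeps (among other components: space-time trees storing all past writes, a log of writes, etc.) an array $C$ of size $U$ (the largest address written so far rounded up to a power of $2$) whose entry $C[i]$ holds the current value of $A[i]$. Read$(i)$ is executed by returning $C[i]$. In the analysis the internal memory is split into three equal parts, one dedicated to each of the primitives Read, Write and Persistent-Read. *)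

theory Defs
  imports Main "HOL-Library.Extended_Nat"
begin

datatype 'v primitive = Read nat | Write nat 'v

fun cell :: "'v primitive \<Rightarrow> nat" where
  "cell (Read i) = i"
| "cell (Write i x) = i"

text \<open>
  The list \<open>hs\<close> is chronological. Since \<^const>\<open>remdups\<close> keeps the last occurrence of every
  element, \<open>rev (remdups hs)\<close> lists the distinct blocks of \<open>hs\<close>, most recently touched first.
\<close>

definition most_recent :: "nat \<Rightarrow> nat list \<Rightarrow> nat set" where
  "most_recent k hs = set (take k (rev (remdups hs)))"

definition ephemeral_cost :: "nat \<Rightarrow> nat \<Rightarrow> 'v primitive list \<Rightarrow> nat" where
  "ephemeral_cost M B ps =
    (let bs = map (\<lambda>p. cell p div B) ps
     in card {t. t < length bs \<and> bs ! t \<notin> most_recent (M div B) (take t bs)})"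

text \<open>
  Optimal block replacement. A schedule gives, for each access, the set of blocks residing in
  internal memory during that access. The number of transfers is the number of blocks brought in;
  only read accesses are executed here, so dropping a block costs nothing. The value is \<open>\<infinity>\<close> if no
  schedule exists, i.e. if internal memory cannot hold a single block.
\<close>

definition schedule :: "nat \<Rightarrow> nat \<Rightarrow> nat list \<Rightarrow> nat set list \<Rightarrow> bool" where
  "schedule M B as Ss \<longleftrightarrow>
    list_all2 (\<lambda>a S. finite S \<and> card S \<le> M div B \<and> a div B \<in> S) as Ss"

fun transfers :: "nat set \<Rightarrow> nat set list \<Rightarrow> nat" where
  "transfers S [] = 0"
| "transfers S (S' # Ss) = card (S' - S) + transfers S' Ss"

definition optimal_transfers :: "nat \<Rightarrow> nat \<Rightarrow> nat set \<Rightarrow> nat list \<Rightarrow> enat" where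
  "optimal_transfers M B S as = (INF Ss \<in> {Ss. schedule M B as Ss}. enat (transfers S Ss))"

text \<open>
  A state of the persistent structure: the Writes performed so far (oldest first), the contents of
  external memory, and the address of the first cell of the array \<open>C\<close>. The remaining components
  occupy memory outside \<open>C\<close> and are unconstrained, as Read does not access them. Nothing is assumed
  about the alignment of \<open>C\<close> with block boundaries, since the structure does not know \<open>B\<close>.
\<close>

record 'v persistent =
  history :: "(nat \<times> 'v) list"
  mem :: "nat \<Rightarrow> 'v"
  C_base :: nat

definition current_array :: "(nat \<times> 'v::zero) list \<Rightarrow> nat \<Rightarrow> 'v" where
  "current_array ws = fold (\<lambda>(i, x) A. A(i := x)) ws (\<lambda>_. 0)"

text \<open>
  Addresses start at 0, so rounding up is to the least power of two strictly above all written
  addresses; this makes every written address a valid index of \<open>C\<close>.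
\<close>

definition C_size :: "(nat \<times> 'v) list \<Rightarrow> nat" where
  "C_size ws = (LEAST u. (\<exists>k. u = 2 ^ k) \<and> (\<forall>i \<in> fst ` set ws. i < u))"

definition wf_persistent :: "'v::zero persistent \<Rightarrow> bool" where
  "wf_persistent P \<longleftrightarrow>
    (\<forall>i < C_size (history P). mem P (C_base P + i) = current_array (history P) i)"

text \<open>
  The value returned by Read and the addresses it touches. An index beyond the end of \<open>C\<close> was never
  written; such a Read returns the initial value, and is charged as if \<open>C\<close> extended that far, which
  is at least what an implementation that skips the access would pay.
\<close>

definition persistent_read :: "'v::zero persistent \<Rightarrow> nat \<Rightarrow> 'v \<times> nat list" where
  "persistent_read P i =
    (if i < C_size (history P) then mem P (C_base P + i) else 0, [C_base P + i])"

definition persistent_runtime ::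
  "nat \<Rightarrow> nat \<Rightarrow> nat set \<Rightarrow> 'v::zero persistent \<Rightarrow> nat list \<Rightarrow> enat" where
  "persistent_runtime M B S P is =
    optimal_transfers M B S (concat (map (\<lambda>i. snd (persistent_read P i)) is))"

end

(*
  Let k be the number of blocks in the ephemeral memory of size M/3. Since C need not be aligned
  with block boundaries, a block of A is covered by two consecutive blocks of external memory. Keep
  resident, besides the block being read, the two covering blocks of each of the k most recently
  touched blocks of A; these fit because 2k and 1 are at most M/B. A Read that is ephemerally free
  then brings in nothing, and any other Read brings in at most the two blocks covering the new block
  of A. Optimal replacement can only do better, so the constant is 2.
*)

theory Submission imports Defs begin

text \<open>In a distinct list the filter deletes at most one entry, so every survivor moves forward
  by at most one position.\<close>

lemma set_take_filter_subset:
  assumes "distinct xs"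
  shows "set (take n (filter (\<lambda>x. x \<noteq> b) xs)) \<subseteq> set (take (Suc n) xs)"
  using assms
proof (induction xs arbitrary: n)
  case (Cons a xs)
  show ?case
  proof (cases "a = b")
    case True
    with Cons.prems have "filter (\<lambda>x. x \<noteq> b) xs = xs"
      by (auto simp: filter_id_conv)
    with True show ?thesis by auto
  next
    case False
    with Cons show ?thesis by (cases n) auto
  qed
qed simp

lemma remdups_snoc: "remdups (xs @ [b]) = filter (\<lambda>x. x \<noteq> b) (remdups xs) @ [b]"
  by (induction xs) auto

lemma most_recent_snoc:
  "most_recent (Suc n) (hs @ [b]) = insert b (set (take n (filter (\<lambda>x. x \<noteq> b) (rev (remdups hs)))))"
  unfolding most_recent_def remdups_snoc by (simp add: rev_filter)

text \<open>Touching \<open>b\<close> moves it to the front and never advances another block past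
  position \<open>k\<close>, so \<open>b\<close> is the only possible newcomer.\<close>

lemma most_recent_snoc_subset: "most_recent k (hs @ [b]) \<subseteq> insert b (most_recent k hs)"
proof (cases k)
  case 0
  then show ?thesis by (simp add: most_recent_def)
next
  case (Suc n)
  have "set (take n (filter (\<lambda>x. x \<noteq> b) (rev (remdups hs)))) \<subseteq> most_recent k hs"
    unfolding most_recent_def Suc by (rule set_take_filter_subset) simp
  then show ?thesis unfolding Suc most_recent_snoc by blast
qed

lemma mem_most_recent_snoc: "0 < k \<Longrightarrow> b \<in> most_recent k (hs @ [b])"
  by (cases k) (simp_all add: most_recent_snoc)

lemma finite_most_recent: "finite (most_recent k hs)"
  by (simp add: most_recent_def)

lemma card_most_recent_le: "card (most_recent k hs) \<le> k"
  unfolding most_recent_def by (rule order_trans[OF card_length]) simp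

text \<open>The prefix \<open>hs\<close> of past accesses lets an induction over \<open>bs\<close>
  carry the history along; \<open>hs = []\<close> gives the ephemeral cost.\<close>

definition lru_misses :: "nat \<Rightarrow> nat list \<Rightarrow> nat list \<Rightarrow> nat" where
  "lru_misses k hs bs = card {t. t < length bs \<and> bs ! t \<notin> most_recent k (hs @ take t bs)}"

lemma lru_misses_Cons:
  "lru_misses k hs (b # bs) =
    (if b \<in> most_recent k hs then 0 else 1) + lru_misses k (hs @ [b]) bs"
proof -
  let ?R = "{t. t < length bs \<and> bs ! t \<notin> most_recent k ((hs @ [b]) @ take t bs)}"
  \<comment> \<open>Time 0 is split off, and the later misses are those of the tail shifted by
    \<open>Suc\<close>.\<close>
  have "{t. t < length (b # bs) \<and> (b # bs) ! t \<notin> most_recent k (hs @ take t (b # bs))}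
      = {t. t = 0 \<and> b \<notin> most_recent k hs} \<union> Suc ` ?R" (is "?L = _")
  proof (rule set_eqI)
    fix t
    show "t \<in> ?L \<longleftrightarrow> t \<in> {t. t = 0 \<and> b \<notin> most_recent k hs} \<union> Suc ` ?R"
      by (cases t) auto
  qed
  moreover have "card ({t. t = 0 \<and> b \<notin> most_recent k hs} \<union> Suc ` ?R)
      = card {t::nat. t = 0 \<and> b \<notin> most_recent k hs} + card (Suc ` ?R)"
    by (rule card_Un_disjoint) auto
  ultimately show ?thesis
    unfolding lru_misses_def by (simp add: card_image)
qed

text \<open>Here \<open>q\<close> stands for the external block containing the first cell of
  \<open>C\<close>, which may begin in the middle of that block.\<close>

definition cover :: "nat \<Rightarrow> nat \<Rightarrow> nat set" where
  "cover q b = {q + b, Suc (q + b)}"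

lemma finite_cover: "finite (cover q b)"
  by (simp add: cover_def)

lemma card_cover: "card (cover q b) = 2"
  by (simp add: cover_def)

text \<open>The two offsets within a block sum to less than \<open>2 * B\<close>, so the carry into
  the quotient is 0 or 1.\<close>

lemma shifted_block_in_cover:
  assumes "0 < (B::nat)"
  shows "(base + i) div B \<in> cover (base div B) (i div B)"
proof -
  have "(base mod B + i mod B) div B < 2"
    using assms by (intro less_mult_imp_div_less) (simp add: add_strict_mono mult_2)
  moreover have "(base + i) div B = base div B + i div B + (base mod B + i mod B) div B"
    by (rule div_add1_eq)
  ultimately show ?thesis by (auto simp: cover_def less_2_cases_iff)
qed

text \<open>The inclusion in \<open>S\<close> is the induction invariant; being only an inclusion,
  it tolerates arbitrary further resident blocks.\<close>

lemma ex_schedule: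
  fixes base B k M :: nat
  assumes "0 < B" and fits: "max 1 (2 * k) \<le> M div B"
    and "\<Union> (cover (base div B) ` most_recent k hs) \<subseteq> S"
  shows "\<exists>Ss. schedule M B (map (\<lambda>i. base + i) is) Ss
    \<and> transfers S Ss \<le> 2 * lru_misses k hs (map (\<lambda>i. i div B) is)"
  using assms(3)
proof (induction "is" arbitrary: hs S)
  case Nil
  show ?case by (rule exI[of _ "[]"]) (simp add: schedule_def)
next
  case (Cons i "is")
  let ?f = "cover (base div B)" and ?b = "i div B" and ?p = "(base + i) div B"
  let ?L = "\<Union> (?f ` most_recent k (hs @ [?b]))"
  \<comment> \<open>Inserting \<open>?p\<close> matters only for \<open>k = 0\<close>, where
    \<open>?L\<close> is empty; otherwise \<open>?p\<close> already lies in the cover of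
    \<open>?b\<close>.\<close>
  let ?S = "insert ?p ?L"
  obtain Ss where Ss: "schedule M B (map (\<lambda>i. base + i) is) Ss"
    and le: "transfers ?S Ss \<le> 2 * lru_misses k (hs @ [?b]) (map (\<lambda>i. i div B) is)"
    using Cons.IH[of "hs @ [?b]" ?S] by blast
  have p: "?p \<in> ?f ?b" by (rule shifted_block_in_cover[OF \<open>0 < B\<close>])
  have fin: "finite ?S" by (simp add: finite_most_recent finite_cover)
  have "card ?S \<le> M div B"
  proof (cases "k = 0")
    case True
    then show ?thesis using fits by (simp add: most_recent_def)
  next
    case False
    then have "?S = ?L" using mem_most_recent_snoc[of k ?b hs] p by blast
    moreover have "card ?L \<le> (\<Sum>b\<in>most_recent k (hs @ [?b]). card (?f b))"
      by (rule card_UN_le[OF finite_most_recent])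
    ultimately have "card ?S \<le> 2 * card (most_recent k (hs @ [?b]))"
      by (simp add: card_cover mult.commute)
    with card_most_recent_le[of k "hs @ [?b]"] fits show ?thesis by linarith
  qed
  with fin Ss have sched: "schedule M B (map (\<lambda>i. base + i) (i # is)) (?S # Ss)"
    by (simp add: schedule_def)
  have new: "?S - S \<subseteq> ?f ?b"
    using most_recent_snoc_subset[of k hs ?b] Cons.prems p by blast
  \<comment> \<open>On a hit the invariant puts the whole cover of \<open>?b\<close> in
    \<open>S\<close>; on a miss its two blocks bound the load.\<close>
  have cost: "card (?S - S) \<le> 2 * (if ?b \<in> most_recent k hs then 0 else 1)"
  proof (cases "?b \<in> most_recent k hs")
    case True
    then have "?f ?b \<subseteq> S" using Cons.prems by blast
    with new have empty: "?S - S = {}" by blast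
    show ?thesis unfolding empty by simp
  next
    case False
    then show ?thesis using card_mono[OF finite_cover new] by (simp add: card_cover)
  qed
  have "transfers S (?S # Ss) \<le> 2 * lru_misses k hs (map (\<lambda>i. i div B) (i # is))"
    using cost le by (simp only: transfers.simps list.map lru_misses_Cons distrib_left add_mono)
  with sched show ?case by blast
qed

lemma persistent_runtime_le:
  fixes P :: "'v::zero persistent" and X :: "nat list" and S :: "nat set"
  assumes "1 \<le> B" and "B \<le> M"
  shows "persistent_runtime M B S P X
    \<le> enat (2 * ephemeral_cost (M div 3) B (map Read X :: 'v primitive list))"
proof -
  define k where "k = M div 3 div B"
  have addresses: "concat (map (\<lambda>i. snd (persistent_read P i)) X) = map (\<lambda>i. C_base P + i) X"
    by (induction X) (simp_all add: persistent_read_def)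
  \<comment> \<open>Swapping the divisions exhibits \<open>k\<close> as a third of the real
    capacity, rounded down, so \<open>2 * k\<close> blocks fit.\<close>
  have "k = M div B div 3"
    unfolding k_def by (metis div_mult2_eq mult.commute)
  moreover have "1 \<le> M div B"
    using assms by (simp add: Suc_le_eq div_greater_zero_iff)
  ultimately have "max 1 (2 * k) \<le> M div B" by linarith
  \<comment> \<open>With no history the invariant is vacuous, so any initial memory \<open>S\<close>
    is allowed.\<close>
  moreover have "\<Union> (cover (C_base P div B) ` most_recent k []) \<subseteq> S"
    by (simp add: most_recent_def)
  ultimately obtain Ss where "schedule M B (map (\<lambda>i. C_base P + i) X) Ss"
    and le: "transfers S Ss \<le> 2 * lru_misses k [] (map (\<lambda>i. i div B) X)"
    using ex_schedule[of B k M "C_base P" "[]" S X] \<open>1 \<le> B\<close> by auto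
  then have "persistent_runtime M B S P X \<le> enat (transfers S Ss)"
    unfolding persistent_runtime_def optimal_transfers_def addresses by (auto intro: INF_lower)
  moreover have "ephemeral_cost (M div 3) B (map Read X :: 'v primitive list)
      = lru_misses k [] (map (\<lambda>i. i div B) X)"
    by (simp add: ephemeral_cost_def lru_misses_def k_def o_def Let_def)
  ultimately show ?thesis using le by (metis enat_ord_simps(1) order_trans)
qed

theorem theorem1:
  "\<exists>c::nat. \<forall>(P :: 'v::zero persistent) (X :: nat list) (M::nat) (B::nat) (S :: nat set).
     wf_persistent P \<longrightarrow> 1 \<le> B \<longrightarrow> B \<le> M \<longrightarrow> finite S \<longrightarrow> card S \<le> M div B \<longrightarrow>
     persistent_runtime M B S P X
       \<le> enat (c * ephemeral_cost (M div 3) B (map Read X :: 'v primitive list))"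
  using persistent_runtime_le by blast

end
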